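(* Let $(P;{}^-,{}^{\sim},\circ,\ast,0,1)$ be a pseudo Sasaki algebra. Define a partial operation $\oplus$ on $P$ by: $a\oplus b$ is defined if and only if $a\le b^-$ (equivalently $b\le a^{\sim}$), and in that case $a\oplus b:=(a^{\sim}\circ b^{\sim})^-=(b^-\ast a^-)^{\sim}$. Then $(P;\oplus,0,1)$ is a lattice ordered pseudo-effect algebra.
   Context: A pseudo Sasaki algebra is a structure $(P;{}^-,{}^{\sim},\circ,\ast,0,1)$ where $P$ is a bounded poset under $\le$ with least element $0$ and greatest element $1$, ${}^-,{}^{\sim}$ are unary operations and $\circ,\ast$ are (total) binary operations on $P$, satisfying for all $a,b,c\in P$: (1) $a^{-\sim}=a^{\sim -}=a$ (where $a^{-\sim}=(a^-)^{\sim}$, etc.), and $a\le b$ implies $b^-\le a^-$ and $b^{\sim}\le a^{\sim}$; (2) $a\circ 1=1\circ a=a=1\ast a=a\ast 1$; (3) $a\circ b\le c\iff a\ast c^-\le b^-$; and $a\ast b\le c\iff a\circ c^{\sim}\le b^{\sim}$; (4) $c\le a$ and $c\le b$ imply $c\le a\circ(a\ast b^-)^{\sim}=a\ast(a\circ b^{\sim})^-$; (5) $a\le b^-$ and $c\le a^{\sim}\circ b^{\sim}$ imply $(a^{\sim}\circ b^{\sim})\circ c^{\sim}=a^{\sim}\circ(b^{\sim}\circ c^{\sim})$; and $c\le b^{\sim}$ and $a\le c^-\ast b^-$ imply $c^-\ast(b^-\ast a^-)=(c^-\ast b^-)\ast a^-$; (6) $a\le b^-$ implies $(a^{\sim}\circ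 b^{\sim})^-=(b^-\ast a^-)^{\sim}$. A pseudo-effect algebra (PEA) is a partial algebra $(P;\oplus,0,1)$, with $\oplus$ a partial binary operation and $0,1$ constants, such that for all $a,b,c\in P$: (PE1) $a\oplus b$ and $(a\oplus b)\oplus c$ exist iff $b\oplus c$ and $a\oplus(b\oplus c)$ exist, and in this case $(a\oplus b)\oplus c=a\oplus(b\oplus c)$; (PE2) there exist exactly one $d\in P$ and exactly one $e\in P$ with $a\oplus d=e\oplus a=1$; (PE3) if $a\oplus b$ exists, there are $d,e\in P$ with $a\oplus b=d\oplus a=b\oplus e$; (PE4) if $a\oplus 1$ or $1\oplus a$ exists, then $a=0$. The partial order of a PEA is: $a\le b$ iff $c\oplus a=b$ for some $c\in P$, equivalently iff $a\oplus d=b$ for some $d\in P$. A PEA is lattice ordered (an LPEA) if it is a lattice under this order. *)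

theory Defs
  imports Main
begin

text \<open>The bounded poset is a type of class \<^class>\<open>order_bot\<close> and \<^class>\<open>order_top\<close>; the constants
  0 and 1 of the algebra are \<^term>\<open>bot\<close> and \<^term>\<open>top\<close>.\<close>

locale pseudo_sasaki_algebra =
  fixes lneg :: "'a::{order_bot,order_top} \<Rightarrow> 'a"  ("_\<^sup>-" [1000] 1000)
    and rneg :: "'a \<Rightarrow> 'a"  ("_\<^sup>~" [1000] 1000)
    and circ :: "'a \<Rightarrow> 'a \<Rightarrow> 'a"  (infixl "\<circ>\<^sub>S" 70)
    and ast :: "'a \<Rightarrow> 'a \<Rightarrow> 'a"  (infixl "\<ast>\<^sub>S" 70)
  assumes rneg_lneg: "(a\<^sup>-)\<^sup>~ = a"
    and lneg_rneg: "(a\<^sup>~)\<^sup>- = a"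
    and lneg_antimono: "a \<le> b \<Longrightarrow> b\<^sup>- \<le> a\<^sup>-"
    and rneg_antimono: "a \<le> b \<Longrightarrow> b\<^sup>~ \<le> a\<^sup>~"
    and circ_top: "a \<circ>\<^sub>S top = a"
    and top_circ: "top \<circ>\<^sub>S a = a"
    and top_ast: "top \<ast>\<^sub>S a = a"
    and ast_top: "a \<ast>\<^sub>S top = a"
    and circ_le_iff: "a \<circ>\<^sub>S b \<le> c \<longleftrightarrow> a \<ast>\<^sub>S c\<^sup>- \<le> b\<^sup>-"
    and ast_le_iff: "a \<ast>\<^sub>S b \<le> c \<longleftrightarrow> a \<circ>\<^sub>S c\<^sup>~ \<le> b\<^sup>~"
    and le_meet_term: "c \<le> a \<Longrightarrow> c \<le> b \<Longrightarrow>
      c \<le> a \<circ>\<^sub>S (a \<ast>\<^sub>S b\<^sup>-)\<^sup>~ \<and> a \<circ>\<^sub>S (a \<ast>\<^sub>S b\<^sup>-)\<^sup>~ = a \<ast>\<^sub>S (a \<circ>\<^sub>S b\<^sup>~)\<^sup>-"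
    and circ_assoc: "a \<le> b\<^sup>- \<Longrightarrow> c \<le> a\<^sup>~ \<circ>\<^sub>S b\<^sup>~ \<Longrightarrow>
      (a\<^sup>~ \<circ>\<^sub>S b\<^sup>~) \<circ>\<^sub>S c\<^sup>~ = a\<^sup>~ \<circ>\<^sub>S (b\<^sup>~ \<circ>\<^sub>S c\<^sup>~)"
    and ast_assoc: "c \<le> b\<^sup>~ \<Longrightarrow> a \<le> c\<^sup>- \<ast>\<^sub>S b\<^sup>- \<Longrightarrow>
      c\<^sup>- \<ast>\<^sub>S (b\<^sup>- \<ast>\<^sub>S a\<^sup>-) = (c\<^sup>- \<ast>\<^sub>S b\<^sup>-) \<ast>\<^sub>S a\<^sup>-"
    and lneg_circ: "a \<le> b\<^sup>- \<Longrightarrow> (a\<^sup>~ \<circ>\<^sub>S b\<^sup>~)\<^sup>- = (b\<^sup>- \<ast>\<^sub>S a\<^sup>-)\<^sup>~"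
begin

definition oplus :: "'a \<Rightarrow> 'a \<Rightarrow> 'a option" where
  "oplus a b = (if a \<le> b\<^sup>- then Some ((a\<^sup>~ \<circ>\<^sub>S b\<^sup>~)\<^sup>-) else None)"

lemma le_lneg_iff_le_rneg: "a \<le> b\<^sup>- \<longleftrightarrow> b \<le> a\<^sup>~"
  by (metis lneg_antimono lneg_rneg rneg_antimono rneg_lneg)

lemma oplus_alt: "oplus a b = (if b \<le> a\<^sup>~ then Some ((b\<^sup>- \<ast>\<^sub>S a\<^sup>-)\<^sup>~) else None)"
  by (simp add: oplus_def le_lneg_iff_le_rneg [symmetric] lneg_circ)

end

text \<open>A partial binary operation is a function into \<^typ>\<open>'a option\<close>, with \<^term>\<open>None\<close>
  meaning undefined.\<close>

locale pseudo_effect_algebra =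
  fixes padd :: "'a \<Rightarrow> 'a \<Rightarrow> 'a option"  (infixl "\<oplus>" 65)
    and zero :: 'a  ("\<zero>")
    and one :: 'a  ("\<one>")
  assumes padd_assoc_defined:
      "(\<exists>d. a \<oplus> b = Some d \<and> d \<oplus> c \<noteq> None) \<longleftrightarrow> (\<exists>e. b \<oplus> c = Some e \<and> a \<oplus> e \<noteq> None)"
    and padd_assoc:
      "a \<oplus> b = Some d \<Longrightarrow> d \<oplus> c = Some x \<Longrightarrow> b \<oplus> c = Some e \<Longrightarrow> a \<oplus> e = Some y \<Longrightarrow> x = y"
    and ex1_right_complement: "\<exists>!d. a \<oplus> d = Some \<one>"
    and ex1_left_complement: "\<exists>!e. e \<oplus> a = Some \<one>"
    and padd_conjugates:
      "a \<oplus> b = Some c \<Longrightarrow> (\<exists>d. d \<oplus> a = Some c) \<and> (\<exists>e. b \<oplus> e = Some c)"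
    and padd_one_defined: "a \<oplus> \<one> \<noteq> None \<or> \<one> \<oplus> a \<noteq> None \<Longrightarrow> a = \<zero>"
begin

definition pea_le :: "'a \<Rightarrow> 'a \<Rightarrow> bool"  (infix "\<preceq>" 50) where
  "a \<preceq> b \<longleftrightarrow> (\<exists>c. c \<oplus> a = Some b)"

definition pea_less :: "'a \<Rightarrow> 'a \<Rightarrow> bool"  (infix "\<prec>" 50) where
  "a \<prec> b \<longleftrightarrow> a \<preceq> b \<and> a \<noteq> b"

lemma pea_le_iff_right: "a \<preceq> b \<longleftrightarrow> (\<exists>d. a \<oplus> d = Some b)"
  unfolding pea_le_def using padd_conjugates by blast

end

locale lattice_ordered_pea = pseudo_effect_algebra +
  assumes lattice_order: "\<exists>meet join. class.lattice meet pea_le pea_less join"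

end

theory Submission
  imports Defs
begin

text \<open>
  Residuation makes \<open>x \<mapsto> a \<circ> x\<close> and \<open>x \<mapsto> a \<ast> x\<close> monotone maps with values below \<open>a\<close>,
  and axiom \<open>le_meet_term\<close> then says that \<open>a \<circ> (a \<ast> b\<^sup>-)\<^sup>~\<close> is the meet of \<open>a\<close> and \<open>b\<close>. Since a negation
  is an antitone bijection, \<open>P\<close> is a lattice. The same formula says that
  whenever \<open>a \<le> c\<close>, the element \<open>c\<close> equals \<open>a \<oplus> (a\<^sup>~ \<ast> c)\<close> (lemma \<open>oplus_difference\<close>); together
  with \<open>a, b \<le> a \<oplus> b\<close> this gives the conjugates of a sum and shows that the order of the
  pseudo-effect algebra is the given one. Complements are unique because \<open>a\<^sup>~ \<circ> b\<^sup>~ = 0\<close> means \<open>a\<^sup>~ \<le> b\<close>.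

  The delicate point is associativity, where the axioms give the equality of the two sums but not that
  one exists when the other does. Suppose \<open>(a \<oplus> b) \<oplus> c\<close> exists and put \<open>z = a\<^sup>~ \<circ> b\<^sup>~\<close> and
  \<open>e = b \<oplus> c\<close>. Axiom \<open>circ_assoc\<close> states \<open>z \<circ> x\<^sup>~ = a\<^sup>~ \<circ> (b\<^sup>~ \<circ> x\<^sup>~)\<close> for \<open>x \<le> z\<close>; passing to adjoints turns
  this into \<open>z \<ast> u = b\<^sup>~ \<ast> (a\<^sup>~ \<ast> u)\<close> for every \<open>u\<close> (lemma \<open>ast_circ_rneg\<close>). With
  \<open>u = (z \<circ> c\<^sup>~)\<^sup>-\<close>, axiom \<open>le_meet_term\<close> evaluates the left side to \<open>c = b\<^sup>~ \<ast> e\<close> and the right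
  side to \<open>b\<^sup>~ \<ast> (a\<^sup>~ \<sqinter> e)\<close>. As \<open>b\<^sup>~ \<ast> _\<close> is injective above \<open>b\<close>, it follows that
  \<open>e = a\<^sup>~ \<sqinter> e \<le> a\<^sup>~\<close>, that is, \<open>a \<oplus> e\<close> exists. The converse direction, like every other
  left-right variant, follows from the symmetry of the axioms (lemma \<open>dual\<close>).
\<close>

context pseudo_sasaki_algebra
begin

section \<open>Symmetry, residuation and the lattice structure\<close>

text \<open>The axioms are invariant under exchanging the two negations together with the two
  products; this reverses the arguments of \<open>\<oplus>\<close>.\<close>

lemma dual: "pseudo_sasaki_algebra rneg lneg ast circ"
proof
  show "a \<circ>\<^sub>S b \<le> c \<longleftrightarrow> a \<ast>\<^sub>S c\<^sup>- \<le> b\<^sup>-" for a b c by (rule circ_le_iff)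
  show "a \<ast>\<^sub>S b \<le> c \<longleftrightarrow> a \<circ>\<^sub>S c\<^sup>~ \<le> b\<^sup>~" for a b c by (rule ast_le_iff)
  show "c \<le> a \<ast>\<^sub>S (a \<circ>\<^sub>S b\<^sup>~)\<^sup>- \<and> a \<ast>\<^sub>S (a \<circ>\<^sub>S b\<^sup>~)\<^sup>- = a \<circ>\<^sub>S (a \<ast>\<^sub>S b\<^sup>-)\<^sup>~"
    if "c \<le> a" "c \<le> b" for a b c
    using le_meet_term [OF that] by metis
  show "(a\<^sup>- \<ast>\<^sub>S b\<^sup>-)\<^sup>~ = (b\<^sup>~ \<circ>\<^sub>S a\<^sup>~)\<^sup>-" if "a \<le> b\<^sup>~" for a b
    using that lneg_circ le_lneg_iff_le_rneg by metis
qed (simp_all add: rneg_lneg lneg_rneg lneg_antimono rneg_antimono circ_top top_circ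
      top_ast ast_top circ_assoc ast_assoc)

lemma oplus_dual: "pseudo_sasaki_algebra.oplus rneg lneg ast a b = oplus b a"
  by (simp add: pseudo_sasaki_algebra.oplus_def [OF dual] oplus_alt)

lemma lneg_le_iff: "a\<^sup>- \<le> b\<^sup>- \<longleftrightarrow> b \<le> a"
  by (metis lneg_antimono rneg_antimono rneg_lneg)

lemma rneg_le_iff: "a\<^sup>~ \<le> b\<^sup>~ \<longleftrightarrow> b \<le> a"
  by (metis rneg_antimono lneg_antimono lneg_rneg)

lemma lneg_bounds: "bot\<^sup>- = top" "top\<^sup>- = bot"
proof -
  show "bot\<^sup>- = top"
    by (simp add: top_unique [symmetric] le_lneg_iff_le_rneg)
  have "top\<^sup>- \<le> (bot\<^sup>~)\<^sup>-"
    by (simp only: lneg_le_iff top_greatest)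
  then show "top\<^sup>- = bot"
    by (simp add: lneg_rneg bot_unique)
qed

lemma circ_le_iff_le_rneg: "a \<circ>\<^sub>S b \<le> c \<longleftrightarrow> b \<le> (a \<ast>\<^sub>S c\<^sup>-)\<^sup>~"
  by (metis circ_le_iff le_lneg_iff_le_rneg)

lemma circ_mono: "b \<le> c \<Longrightarrow> a \<circ>\<^sub>S b \<le> a \<circ>\<^sub>S c"
  by (meson circ_le_iff_le_rneg order.refl order.trans)

lemma circ_le_left: "a \<circ>\<^sub>S b \<le> a"
  using circ_mono [of b top a] by (simp add: circ_top)

lemma ast_le_left: "a \<ast>\<^sub>S b \<le> a"
  by (rule pseudo_sasaki_algebra.circ_le_left [OF dual])

lemma circ_le_bot_iff: "a \<circ>\<^sub>S b \<le> bot \<longleftrightarrow> a \<le> b\<^sup>-"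
  by (simp add: circ_le_iff lneg_bounds ast_top)

lemma meet_terms_eq: "a \<circ>\<^sub>S (a \<ast>\<^sub>S b\<^sup>-)\<^sup>~ = a \<ast>\<^sub>S (a \<circ>\<^sub>S b\<^sup>~)\<^sup>-"
  using le_meet_term [of bot a b] by simp

definition meet :: "'a \<Rightarrow> 'a \<Rightarrow> 'a"
  where "meet a b = a \<circ>\<^sub>S (a \<ast>\<^sub>S b\<^sup>-)\<^sup>~"

text \<open>The lower bound property is the counit of the adjunction between \<open>a \<circ> _\<close> and
  \<open>(a \<ast> _\<^sup>-)\<^sup>~\<close>.\<close>

lemma le_meet_iff: "c \<le> meet a b \<longleftrightarrow> c \<le> a \<and> c \<le> b"
proof -
  have "meet a b \<le> a" "meet a b \<le> b"
    by (simp_all add: meet_def circ_le_left circ_le_iff_le_rneg)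
  then show ?thesis
    using le_meet_term [of c a b] by (auto simp: meet_def intro: order.trans)
qed

lemma meet_absorb: "b \<le> a \<Longrightarrow> meet a b = b"
  using le_meet_iff [of "meet a b" a b] by (simp add: order.eq_iff le_meet_iff)

definition join :: "'a \<Rightarrow> 'a \<Rightarrow> 'a"
  where "join a b = (meet (a\<^sup>~) (b\<^sup>~))\<^sup>-"

lemma join_le_iff: "join a b \<le> c \<longleftrightarrow> a \<le> c \<and> b \<le> c"
proof -
  have "join a b \<le> c \<longleftrightarrow> c\<^sup>~ \<le> meet (a\<^sup>~) (b\<^sup>~)"
    by (metis join_def lneg_le_iff lneg_rneg)
  then show ?thesis by (simp add: le_meet_iff rneg_le_iff)
qed

lemma lattice: "class.lattice meet (\<le>) (<) join"
  by unfold_locales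
     (meson le_meet_iff order.refl join_le_iff)+


section \<open>The partial sum and its order\<close>

lemma oplus_eq_Some_iff: "oplus a b = Some c \<longleftrightarrow> a \<le> b\<^sup>- \<and> c = (a\<^sup>~ \<circ>\<^sub>S b\<^sup>~)\<^sup>-"
  by (auto simp: oplus_def)

text \<open>Above \<open>a\<close> the map \<open>c \<mapsto> a\<^sup>~ \<ast> c\<close> has an explicit left inverse: this is axiom \<open>le_meet_term\<close> for
  \<open>c\<^sup>~ \<le> a\<^sup>~\<close>.\<close>

lemma lneg_circ_rneg_ast: "a \<le> c \<Longrightarrow> (a\<^sup>~ \<circ>\<^sub>S (a\<^sup>~ \<ast>\<^sub>S c)\<^sup>~)\<^sup>- = c"
  using meet_absorb [of "c\<^sup>~" "a\<^sup>~"] by (simp add: meet_def lneg_rneg rneg_le_iff)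

lemma oplus_difference: "a \<le> c \<Longrightarrow> oplus a (a\<^sup>~ \<ast>\<^sub>S c) = Some c"
  by (simp add: oplus_eq_Some_iff lneg_circ_rneg_ast le_lneg_iff_le_rneg ast_le_left)

lemma oplus_difference_left: "a \<le> c \<Longrightarrow> \<exists>d. oplus d a = Some c"
  using pseudo_sasaki_algebra.oplus_difference [OF dual] by (auto simp: oplus_dual)

lemma oplus_ge_left: "oplus a b = Some c \<Longrightarrow> a \<le> c"
  by (metis circ_le_left lneg_antimono lneg_rneg oplus_eq_Some_iff)

lemma oplus_ge_right: "oplus a b = Some c \<Longrightarrow> b \<le> c"
  using pseudo_sasaki_algebra.oplus_ge_left [OF dual] by (simp add: oplus_dual)

lemma oplus_eq_top_iff: "oplus a b = Some top \<longleftrightarrow> b = a\<^sup>~"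
proof -
  have "(a\<^sup>~ \<circ>\<^sub>S b\<^sup>~)\<^sup>- = top \<longleftrightarrow> a\<^sup>~ \<circ>\<^sub>S b\<^sup>~ \<le> bot"
    by (metis bot.extremum_unique lneg_bounds(1) rneg_lneg)
  also have "\<dots> \<longleftrightarrow> a\<^sup>~ \<le> b"
    by (simp add: circ_le_bot_iff lneg_rneg)
  finally show ?thesis
    by (auto simp: oplus_eq_Some_iff le_lneg_iff_le_rneg order.eq_iff)
qed

lemma oplus_eq_top_iff_left: "oplus a b = Some top \<longleftrightarrow> a = b\<^sup>-"
  using pseudo_sasaki_algebra.oplus_eq_top_iff [OF dual] by (simp add: oplus_dual)


section \<open>Existence of associated sums\<close>

text \<open>The adjoint form of axiom \<open>circ_assoc\<close>. On elements \<open>x\<close> below \<open>z = a\<^sup>~ \<circ> b\<^sup>~\<close> the axiom and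
  residuation show that \<open>x\<close> bounds \<open>z \<ast> u\<close> if and only if it bounds \<open>b\<^sup>~ \<ast> (a\<^sup>~ \<ast> u)\<close>. As
  \<open>z \<ast> u\<close> itself lies below \<open>z\<close>, so does the other term, and the two bound each other; hence
  no restriction on \<open>u\<close> remains.\<close>

lemma ast_circ_rneg:
  assumes ab: "a \<le> b\<^sup>-"
  shows "(a\<^sup>~ \<circ>\<^sub>S b\<^sup>~) \<ast>\<^sub>S u = b\<^sup>~ \<ast>\<^sub>S (a\<^sup>~ \<ast>\<^sub>S u)"
proof -
  define z where "z = a\<^sup>~ \<circ>\<^sub>S b\<^sup>~"
  have same_bounds: "z \<ast>\<^sub>S u \<le> x \<longleftrightarrow> b\<^sup>~ \<ast>\<^sub>S (a\<^sup>~ \<ast>\<^sub>S u) \<le> x" if "x \<le> z" for x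
  proof -
    have "z \<ast>\<^sub>S u \<le> x \<longleftrightarrow> a\<^sup>~ \<circ>\<^sub>S (b\<^sup>~ \<circ>\<^sub>S x\<^sup>~) \<le> u\<^sup>~"
      using ast_le_iff circ_assoc [OF ab] that by (simp add: z_def)
    also have "\<dots> \<longleftrightarrow> b\<^sup>~ \<circ>\<^sub>S x\<^sup>~ \<le> (a\<^sup>~ \<ast>\<^sub>S u)\<^sup>~"
      by (simp add: circ_le_iff_le_rneg lneg_rneg)
    also have "\<dots> \<longleftrightarrow> b\<^sup>~ \<ast>\<^sub>S (a\<^sup>~ \<ast>\<^sub>S u) \<le> x"
      by (rule ast_le_iff [symmetric])
    finally show ?thesis .
  qed
  have le: "b\<^sup>~ \<ast>\<^sub>S (a\<^sup>~ \<ast>\<^sub>S u) \<le> z \<ast>\<^sub>S u"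
    using same_bounds [OF ast_le_left, of u] by simp
  have "z \<ast>\<^sub>S u \<le> b\<^sup>~ \<ast>\<^sub>S (a\<^sup>~ \<ast>\<^sub>S u)"
    using same_bounds [OF order.trans [OF le ast_le_left]] by simp
  then show ?thesis
    using le unfolding z_def by (rule order.antisym)
qed

lemma oplus_reassoc_right:
  assumes ab: "oplus a b = Some d" and dc: "oplus d c = Some x"
  shows "\<exists>e. oplus b c = Some e \<and> oplus a e = Some x"
proof -
  define z where "z = a\<^sup>~ \<circ>\<^sub>S b\<^sup>~"
  define e where "e = (b\<^sup>~ \<circ>\<^sub>S c\<^sup>~)\<^sup>-"
  have le_ab: "a \<le> b\<^sup>-" and d: "d = z\<^sup>-" and d_le: "d \<le> c\<^sup>-" and x: "x = (z \<circ>\<^sub>S c\<^sup>~)\<^sup>-"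
    using ab dc by (auto simp: oplus_eq_Some_iff z_def rneg_lneg)
  have c_le_z: "c \<le> z"
    using d_le by (simp add: d lneg_le_iff)
  have z_eq: "z = d\<^sup>~"
    by (simp add: d rneg_lneg)
  have c_le: "c \<le> b\<^sup>~"
    using c_le_z oplus_ge_right [OF ab] rneg_antimono z_eq order.trans by blast
  have bc: "oplus b c = Some e"
    using c_le by (simp add: oplus_eq_Some_iff e_def le_lneg_iff_le_rneg)
  have x_eq: "x = (a\<^sup>~ \<circ>\<^sub>S e\<^sup>~)\<^sup>-"
    using circ_assoc [OF le_ab, of c] c_le_z by (simp add: x z_def e_def rneg_lneg)
  have "b\<^sup>~ \<ast>\<^sub>S e = meet (b\<^sup>~) c"
    by (simp add: e_def meet_def meet_terms_eq)
  also have "\<dots> = meet z c"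
    using c_le c_le_z by (simp add: meet_absorb)
  also have "\<dots> = z \<ast>\<^sub>S x"
    by (simp add: meet_def meet_terms_eq x)
  also have "\<dots> = b\<^sup>~ \<ast>\<^sub>S (a\<^sup>~ \<ast>\<^sub>S x)"
    unfolding z_def by (rule ast_circ_rneg [OF le_ab])
  also have "a\<^sup>~ \<ast>\<^sub>S x = meet (a\<^sup>~) e"
    by (simp add: x_eq meet_def meet_terms_eq)
  finally have "b\<^sup>~ \<ast>\<^sub>S e = b\<^sup>~ \<ast>\<^sub>S meet (a\<^sup>~) e" .
  moreover have "b \<le> e"
    using bc by (rule oplus_ge_left)
  moreover have "b \<le> meet (a\<^sup>~) e"
    using \<open>b \<le> e\<close> le_ab by (simp add: le_meet_iff le_lneg_iff_le_rneg)
  ultimately have "e = meet (a\<^sup>~) e"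
    using lneg_circ_rneg_ast by metis
  then have "e \<le> a\<^sup>~"
    using le_meet_iff order.refl by metis
  then have "oplus a e = Some x"
    by (simp add: oplus_eq_Some_iff x_eq le_lneg_iff_le_rneg)
  with bc show ?thesis by blast
qed

lemma oplus_reassoc_left:
  assumes "oplus b c = Some e" and "oplus a e = Some x"
  shows "\<exists>d. oplus a b = Some d \<and> oplus d c = Some x"
  using pseudo_sasaki_algebra.oplus_reassoc_right [OF dual, of c b e a x] assms
  by (simp add: oplus_dual)


section \<open>The lattice ordered pseudo-effect algebra\<close>

lemma pseudo_effect_algebra_oplus: "pseudo_effect_algebra oplus bot top"
proof
  fix a b c d e x y
  show "(\<exists>d. oplus a b = Some d \<and> oplus d c \<noteq> None) \<longleftrightarrow>
      (\<exists>e. oplus b c = Some e \<and> oplus a e \<noteq> None)"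
  proof
    assume "\<exists>d. oplus a b = Some d \<and> oplus d c \<noteq> None"
    then obtain d x where "oplus a b = Some d" "oplus d c = Some x" by auto
    from oplus_reassoc_right [OF this] show "\<exists>e. oplus b c = Some e \<and> oplus a e \<noteq> None"
      by auto
  next
    assume "\<exists>e. oplus b c = Some e \<and> oplus a e \<noteq> None"
    then obtain e x where "oplus b c = Some e" "oplus a e = Some x" by auto
    from oplus_reassoc_left [OF this] show "\<exists>d. oplus a b = Some d \<and> oplus d c \<noteq> None"
      by auto
  qed
  show "x = y" if "oplus a b = Some d" "oplus d c = Some x"
    "oplus b c = Some e" "oplus a e = Some y"
    using oplus_reassoc_right [OF that(1,2)] that(3,4) by simp
  show "\<exists>!d. oplus a d = Some top"
    by (simp add: oplus_eq_top_iff)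
  show "\<exists>!e. oplus e a = Some top"
    by (simp add: oplus_eq_top_iff_left)
  show "(\<exists>d. oplus d a = Some c) \<and> (\<exists>e. oplus b e = Some c)" if "oplus a b = Some c"
    using that oplus_ge_left oplus_ge_right oplus_difference oplus_difference_left by blast
  show "a = bot" if "oplus a top \<noteq> None \<or> oplus top a \<noteq> None"
  proof -
    have "a \<le> top\<^sup>- \<or> top \<le> a\<^sup>-"
      using that by (auto simp: oplus_def split: if_splits)
    moreover have "top \<le> a\<^sup>- \<longleftrightarrow> a \<le> bot"
      by (simp only: lneg_bounds(1) [symmetric] lneg_le_iff)
    ultimately show ?thesis
      by (simp add: lneg_bounds bot_unique)
  qed
qed

lemma pea_le_oplus: "pseudo_effect_algebra.pea_le oplus = (\<le>)"
proof (intro ext iffI)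
  fix a b
  note pea_le = pseudo_effect_algebra.pea_le_def [OF pseudo_effect_algebra_oplus]
  show "a \<le> b" if "pseudo_effect_algebra.pea_le oplus a b"
    using that oplus_ge_right by (auto simp: pea_le)
  show "pseudo_effect_algebra.pea_le oplus a b" if "a \<le> b"
    using oplus_difference_left [OF that] by (simp add: pea_le)
qed

lemma pea_less_oplus: "pseudo_effect_algebra.pea_less oplus = (<)"
  by (intro ext)
     (simp add: pseudo_effect_algebra.pea_less_def [OF pseudo_effect_algebra_oplus]
       pea_le_oplus order.strict_iff_order)

lemma lattice_ordered_pea_oplus: "lattice_ordered_pea oplus bot top"
  unfolding lattice_ordered_pea_def lattice_ordered_pea_axioms_def pea_le_oplus pea_less_oplus
  using pseudo_effect_algebra_oplus lattice by blast

end

theorem theorem3p8: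
  fixes lneg rneg :: "'a::{order_bot,order_top} \<Rightarrow> 'a"
    and circ ast :: "'a \<Rightarrow> 'a \<Rightarrow> 'a"
  assumes "pseudo_sasaki_algebra lneg rneg circ ast"
  shows "lattice_ordered_pea (pseudo_sasaki_algebra.oplus lneg rneg circ) bot top"
  using assms by (rule pseudo_sasaki_algebra.lattice_ordered_pea_oplus)

end
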